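(* Let $\mathit{Prog}$ be any CLP program (in the setting described in the context, containing the nullary predicate $\mathtt{unsafe}$ and no two identical predicate symbols with different arities). Then the cFAR algorithm applied to $\mathit{Prog}$ terminates and produces a CLP program $\mathit{Prog}|_E$, where $E$ is the erasure it computes, such that $\mathtt{unsafe} \in \mathcal{M}(\mathit{Prog})$ if and only if $\mathtt{unsafe} \in \mathcal{M}(\mathit{Prog}|_E)$.
   Context: A CLP program is a finite set of clauses $\mathtt{H \,\text{:-}\, c, G}$, where $\mathtt{H}$ is an atom, $\mathtt{G}$ a conjunction of atoms and $\mathtt{c}$ a constraint of the form $\mathtt{c_1}\wedge\dots\wedge\mathtt{c_h}$ ($h\ge 0$) of atomic constraints in the theory $\mathcal{A}$ of linear integer arithmetic with integer arrays. $\mathcal{M}(P)$ denotes the least model of $P$; $\mathtt{unsafe}$ is a nullary predicate. An erasure is a set of pairs $(\mathtt{p},k)$ with $\mathtt{p}$ a predicate symbol of arity $n$ and $1\le k\le n$. For an atom $\mathtt{A}$ with predicate $\mathtt{p}$, the erased atom $\mathtt{A}|_E$ is obtained by dropping every argument at a position $k$ with $(\mathtt{p},k)\in E$; $C|_E$ and $\mathit{Prog}|_E$ are obtained by replacing every atom $\mathtt{A}$ by $\mathtt{A}|_E$. Given variables $\mathtt{X},\mathtt{Y}$ and a constraint $\mathtt{c}=\mathtt{c_1}\wedge\dots\wedge\mathtt{c_h}$, $\mathtt{X}$ is constrained to $\mathtt{Y}$ in $\mathtt{c}$ if there is $j$ such that either (i) $\{\mathtt{X},\mathtt{Y}\}\subseteq\mathit{vars}(\mathtt{c_j})$,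 or (ii) there is a variable $\mathtt{Z}$ with $\{\mathtt{X},\mathtt{Z}\}\subseteq\mathit{vars}(\mathtt{c_j})$ and $\mathtt{Z}$ constrained to $\mathtt{Y}$ in $\mathtt{c}$. An erasure $E$ is safe for $\mathit{Prog}$ if for every $(\mathtt{p},k)\in E$ and every clause $\mathtt{H\,\text{:-}\,c,G}$ of $\mathit{Prog}$ with $\mathtt{H}=\mathtt{p(X_1,\dots,X_n)}$ and $\mathtt{c}=\mathtt{c_1}\wedge\dots\wedge\mathtt{c_h}$: (i) $\mathtt{X_k}$ is a variable and $\mathcal{A}\models\forall \mathtt{X_k}\,\exists \mathtt{Y_1},\dots,\mathtt{Y_m}.\,\mathtt{c}$, where $\{\mathtt{Y_1},\dots,\mathtt{Y_m}\}=\mathit{vars}(\mathtt{c})\setminus\{\mathtt{X_k}\}$; (ii) $\mathtt{X_k}$ is not constrained (in $\mathtt{c}$) to any other variable occurring in $\mathtt{H}$; (iii) $\mathtt{X_k}$ is not constrained to any variable occurring in $\mathtt{G}|_E$. The cFAR (constrained FAR) algorithm: initialize $E$ to the full erasure, i.e. the set of all $(\mathtt{p},k)$ with $\mathtt{p}$ a predicate of arity $n$ occurring in $\mathit{Prog}$ and $1\le k\le n$; while $E$ contains a pair $(\mathtt{p},k)$ for which one of conditions (i)–(iii) above fails (for some clause of $\mathit{Prog}$ with head predicate $\mathtt{p}$), remove that pair from $E$; when no pair can be removed, output $\mathit{Prog}|_E$.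
   Formalization: Conditions (ii) and (iii) are strengthened, as the claim fails otherwise: X_k must occur in no other argument of H and must not occur in G|_E, even if it is absent from c. Each predicate has fixed argument sorts (integer or array). *)

theory Defs
  imports Main
begin

text \<open>
  The constraint theory: linear integer arithmetic with integer arrays. It is two-sorted;
  its standard structure interprets the integer sort as \<^typ>\<open>int\<close> and the array sort as the
  total maps \<^typ>\<open>int \<Rightarrow> int\<close>. The relational forms read(A,I,V) and write(A,I,V,B) are the
  atomic constraints V = Read A I and B = Write A I V.
\<close>

datatype var = IV nat | AV nat

datatype iterm =
    IVar nat
  | IConst int
  | Add iterm iterm
  | Scale int iterm
  | Read aterm iterm
and aterm =
    AVar nat
  | Write aterm iterm iterm

datatype tm = IT iterm | AT aterm

datatype atomic_constraint =
    IEq iterm iterm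
  | ILe iterm iterm
  | ILt iterm iterm
  | AEq aterm aterm

text \<open>A constraint is a finite conjunction of atomic constraints; the empty list is \<^emph>\<open>true\<close>.\<close>

type_synonym constraint = "atomic_constraint list"

primrec vars_iterm :: "iterm \<Rightarrow> var set" and vars_aterm :: "aterm \<Rightarrow> var set" where
  "vars_iterm (IVar n) = {IV n}"
| "vars_iterm (IConst i) = {}"
| "vars_iterm (Add s t) = vars_iterm s \<union> vars_iterm t"
| "vars_iterm (Scale i t) = vars_iterm t"
| "vars_iterm (Read a t) = vars_aterm a \<union> vars_iterm t"
| "vars_aterm (AVar n) = {AV n}"
| "vars_aterm (Write a s t) = vars_aterm a \<union> vars_iterm s \<union> vars_iterm t"

primrec vars_tm :: "tm \<Rightarrow> var set" where
  "vars_tm (IT t) = vars_iterm t"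
| "vars_tm (AT a) = vars_aterm a"

primrec vars_atomic :: "atomic_constraint \<Rightarrow> var set" where
  "vars_atomic (IEq s t) = vars_iterm s \<union> vars_iterm t"
| "vars_atomic (ILe s t) = vars_iterm s \<union> vars_iterm t"
| "vars_atomic (ILt s t) = vars_iterm s \<union> vars_iterm t"
| "vars_atomic (AEq a b) = vars_aterm a \<union> vars_aterm b"

definition vars_constraint :: "constraint \<Rightarrow> var set" where
  "vars_constraint c = (\<Union>a\<in>set c. vars_atomic a)"

primrec var_tm :: "var \<Rightarrow> tm" where
  "var_tm (IV n) = IT (IVar n)"
| "var_tm (AV n) = AT (AVar n)"

datatype val = IntV int | ArrV "int \<Rightarrow> int"

datatype valuation = Valuation (ival: "nat \<Rightarrow> int") (aval: "nat \<Rightarrow> int \<Rightarrow> int")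

primrec lookup :: "valuation \<Rightarrow> var \<Rightarrow> val" where
  "lookup \<sigma> (IV n) = IntV (ival \<sigma> n)"
| "lookup \<sigma> (AV n) = ArrV (aval \<sigma> n)"

primrec eval_iterm :: "valuation \<Rightarrow> iterm \<Rightarrow> int"
  and eval_aterm :: "valuation \<Rightarrow> aterm \<Rightarrow> int \<Rightarrow> int" where
  "eval_iterm \<sigma> (IVar n) = ival \<sigma> n"
| "eval_iterm \<sigma> (IConst i) = i"
| "eval_iterm \<sigma> (Add s t) = eval_iterm \<sigma> s + eval_iterm \<sigma> t"
| "eval_iterm \<sigma> (Scale i t) = i * eval_iterm \<sigma> t"
| "eval_iterm \<sigma> (Read a t) = eval_aterm \<sigma> a (eval_iterm \<sigma> t)"
| "eval_aterm \<sigma> (AVar n) = aval \<sigma> n"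
| "eval_aterm \<sigma> (Write a s t) = (eval_aterm \<sigma> a)(eval_iterm \<sigma> s := eval_iterm \<sigma> t)"

primrec eval_tm :: "valuation \<Rightarrow> tm \<Rightarrow> val" where
  "eval_tm \<sigma> (IT t) = IntV (eval_iterm \<sigma> t)"
| "eval_tm \<sigma> (AT a) = ArrV (eval_aterm \<sigma> a)"

primrec sat_atomic :: "valuation \<Rightarrow> atomic_constraint \<Rightarrow> bool" where
  "sat_atomic \<sigma> (IEq s t) \<longleftrightarrow> eval_iterm \<sigma> s = eval_iterm \<sigma> t"
| "sat_atomic \<sigma> (ILe s t) \<longleftrightarrow> eval_iterm \<sigma> s \<le> eval_iterm \<sigma> t"
| "sat_atomic \<sigma> (ILt s t) \<longleftrightarrow> eval_iterm \<sigma> s < eval_iterm \<sigma> t"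
| "sat_atomic \<sigma> (AEq a b) \<longleftrightarrow> eval_aterm \<sigma> a = eval_aterm \<sigma> b"

definition sat :: "valuation \<Rightarrow> constraint \<Rightarrow> bool" where
  "sat \<sigma> c \<longleftrightarrow> (\<forall>a\<in>set c. sat_atomic \<sigma> a)"

text \<open>Validity of \<open>\<forall>X. \<exists>Y\<^sub>1,\<dots>,Y\<^sub>m. c\<close> where \<open>{Y\<^sub>1,\<dots>,Y\<^sub>m} = vars(c) - {X}\<close>.\<close>

definition valid_forall_exists :: "var \<Rightarrow> constraint \<Rightarrow> bool" where
  "valid_forall_exists X c \<longleftrightarrow>
     (\<forall>\<sigma>. \<exists>\<sigma>'. (\<forall>Z. Z \<notin> vars_constraint c - {X} \<longrightarrow> lookup \<sigma>' Z = lookup \<sigma> Z) \<and> sat \<sigma>' c)"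

inductive constrained_to :: "constraint \<Rightarrow> var \<Rightarrow> var \<Rightarrow> bool" for c where
  direct: "a \<in> set c \<Longrightarrow> {X, Y} \<subseteq> vars_atomic a \<Longrightarrow> constrained_to c X Y"
| step: "a \<in> set c \<Longrightarrow> {X, Z} \<subseteq> vars_atomic a \<Longrightarrow> constrained_to c Z Y \<Longrightarrow> constrained_to c X Y"

text \<open>Atoms over terms are the atoms of programs; atoms over values are ground atoms.\<close>

datatype ('p, 't) atom = Atom (pred: 'p) (args: "'t list")

datatype 'p clause =
  Clause (head: "('p, tm) atom") (cons: constraint) (body: "('p, tm) atom list")

type_synonym 'p program = "'p clause set"

definition vars_atom :: "('p, tm) atom \<Rightarrow> var set" where
  "vars_atom A = (\<Union>t\<in>set (args A). vars_tm t)"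

definition eval_atom :: "valuation \<Rightarrow> ('p, tm) atom \<Rightarrow> ('p, val) atom" where
  "eval_atom \<sigma> A = Atom (pred A) (map (eval_tm \<sigma>) (args A))"

definition prog_atoms :: "'p program \<Rightarrow> ('p, tm) atom set" where
  "prog_atoms P = (\<Union>C\<in>P. insert (head C) (set (body C)))"

datatype sort = IntS | ArrS

primrec sort_of :: "tm \<Rightarrow> sort" where
  "sort_of (IT t) = IntS"
| "sort_of (AT a) = ArrS"

text \<open>
  As the constraint theory is two-sorted, a predicate symbol has a fixed list of argument
  sorts; in particular no predicate symbol is used with two different arities.
\<close>

definition clp_program :: "'p program \<Rightarrow> bool" where
  "clp_program P \<longleftrightarrow>
     finite P \<and> (\<exists>sig. \<forall>A\<in>prog_atoms P. map sort_of (args A) = sig (pred A))"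

definition is_model :: "('p, val) atom set \<Rightarrow> 'p program \<Rightarrow> bool" where
  "is_model I P \<longleftrightarrow>
     (\<forall>C\<in>P. \<forall>\<sigma>. sat \<sigma> (cons C) \<longrightarrow> (\<forall>A\<in>set (body C). eval_atom \<sigma> A \<in> I) \<longrightarrow>
        eval_atom \<sigma> (head C) \<in> I)"

definition least_model :: "'p program \<Rightarrow> ('p, val) atom set" where
  "least_model P = \<Inter>{I. is_model I P}"

lemma is_model_least_model: "is_model (least_model P) P"
  unfolding is_model_def least_model_def by blast

lemma least_model_least: "is_model I P \<Longrightarrow> least_model P \<subseteq> I"
  unfolding least_model_def by blast

text \<open>Argument positions in erasures are counted from 1, list positions from 0.\<close>

type_synonym 'p erasure = "('p \<times> nat) set"

definition erase_atom :: "'p erasure \<Rightarrow> ('p, 't) atom \<Rightarrow> ('p, 't) atom" where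
  "erase_atom E A = Atom (pred A) (nths (args A) {i. (pred A, Suc i) \<notin> E})"

definition erase_clause :: "'p erasure \<Rightarrow> 'p clause \<Rightarrow> 'p clause" where
  "erase_clause E C =
     Clause (erase_atom E (head C)) (cons C) (map (erase_atom E) (body C))"

definition erase_program :: "'p erasure \<Rightarrow> 'p program \<Rightarrow> 'p program" where
  "erase_program E P = erase_clause E ` P"

definition full_erasure :: "'p program \<Rightarrow> 'p erasure" where
  "full_erasure P = {(p, k). \<exists>A\<in>prog_atoms P. pred A = p \<and> 1 \<le> k \<and> k \<le> length (args A)}"

text \<open>
  Conditions (i)--(iii) for the \<open>k\<close>-th head argument \<open>X\<close> of a clause. A variable counts as
  constrained to itself even if it does not occur in the constraint, which
  \<^const>\<open>constrained_to\<close> does not cover; hence the requirements that \<open>X\<close> occurs in no other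
  argument of the head and does not occur in the erased body. Without the former,
  \<open>{p(X,X) :- true.  unsafe :- A=1, B=2, p(A,B).}\<close> and without the latter
  \<open>{q(X) :- X=2.  p(X) :- q(X).  unsafe :- A=1, p(A).}\<close> would be erased to a program in
  which \<open>unsafe\<close> becomes derivable.
\<close>

definition safe_position :: "'p erasure \<Rightarrow> 'p clause \<Rightarrow> nat \<Rightarrow> bool" where
  "safe_position E C k \<longleftrightarrow>
     (\<exists>X. args (head C) ! (k - 1) = var_tm X \<and> valid_forall_exists X (cons C) \<and>
        (\<forall>j<length (args (head C)). j \<noteq> k - 1 \<longrightarrow> X \<notin> vars_tm (args (head C) ! j)) \<and>
        (\<forall>Y\<in>vars_atom (head C). Y \<noteq> X \<longrightarrow> \<not> constrained_to (cons C) X Y) \<and>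
        (\<forall>A\<in>set (body C). \<forall>Y\<in>vars_atom (erase_atom E A).
           Y \<noteq> X \<and> \<not> constrained_to (cons C) X Y))"

text \<open>
  The algorithm is nondeterministic in the choice of the pair to be removed: one step is one
  iteration of the loop, and an output is any erasure at which a run from the full erasure stops.
\<close>

inductive cfar_step :: "'p program \<Rightarrow> 'p erasure \<Rightarrow> 'p erasure \<Rightarrow> bool" for P where
  remove: "(p, k) \<in> E \<Longrightarrow> C \<in> P \<Longrightarrow> pred (head C) = p \<Longrightarrow> \<not> safe_position E C k \<Longrightarrow>
     cfar_step P E (E - {(p, k)})"

definition cfar_terminates :: "'p program \<Rightarrow> bool" where
  "cfar_terminates P \<longleftrightarrow>
     \<not> (\<exists>f :: nat \<Rightarrow> 'p erasure. f 0 = full_erasure P \<and> (\<forall>i. cfar_step P (f i) (f (Suc i))))"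

definition cfar_output :: "'p program \<Rightarrow> 'p erasure \<Rightarrow> bool" where
  "cfar_output P E \<longleftrightarrow> (cfar_step P)\<^sup>*\<^sup>* (full_erasure P) E \<and> \<not> (\<exists>E'. cfar_step P E E')"

end

theory Submission
  imports Defs
begin

text \<open>
  If \<open>E\<close> satisfies conditions (i)--(iii), then for every model \<open>I\<close> of \<open>P\<close> the ground atoms
  \<^emph>\<open>all\<close> of whose well-sorted preimages under erasure lie in \<open>I\<close> form a model of the erased
  program. Indeed, let a clause instance be given by \<open>\<sigma>\<close> and consider one erased head argument,
  a variable \<open>X\<close>. Condition (i) yields a solution \<open>\<rho>\<close> of the constraint giving \<open>X\<close> any value we
  like. By (ii) and (iii) the connected component of \<open>X\<close> in the constraint avoids the other head
  arguments and the erased body; so the valuation that is \<open>\<rho>\<close> on this component and \<open>\<sigma>\<close>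
  elsewhere still solves the constraint and changes nothing but the chosen argument. Repeating
  this for each erased head argument produces every well-sorted preimage of the erased head.
\<close>

subsection \<open>Valuations\<close>

definition agree_on :: "var set \<Rightarrow> valuation \<Rightarrow> valuation \<Rightarrow> bool" where
  "agree_on V \<sigma> \<tau> \<longleftrightarrow> (\<forall>X\<in>V. lookup \<sigma> X = lookup \<tau> X)"

lemma agree_on_Un [simp]: "agree_on (V \<union> W) \<sigma> \<tau> \<longleftrightarrow> agree_on V \<sigma> \<tau> \<and> agree_on W \<sigma> \<tau>"
  by (auto simp: agree_on_def)

lemma agree_on_singleton [simp]: "agree_on {X} \<sigma> \<tau> \<longleftrightarrow> lookup \<sigma> X = lookup \<tau> X"
  by (simp add: agree_on_def)

lemma agree_on_subset: "agree_on W \<sigma> \<tau> \<Longrightarrow> V \<subseteq> W \<Longrightarrow> agree_on V \<sigma> \<tau>"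
  by (auto simp: agree_on_def)

lemma eval_iterm_cong: "agree_on (vars_iterm t) \<sigma> \<tau> \<Longrightarrow> eval_iterm \<sigma> t = eval_iterm \<tau> t"
  and eval_aterm_cong: "agree_on (vars_aterm a) \<sigma> \<tau> \<Longrightarrow> eval_aterm \<sigma> a = eval_aterm \<tau> a"
  by (induction t and a) auto

lemma eval_tm_cong: "agree_on (vars_tm t) \<sigma> \<tau> \<Longrightarrow> eval_tm \<sigma> t = eval_tm \<tau> t"
  by (cases t) (auto dest: eval_iterm_cong eval_aterm_cong)

lemma eval_atom_cong: "agree_on (vars_atom A) \<sigma> \<tau> \<Longrightarrow> eval_atom \<sigma> A = eval_atom \<tau> A"
  by (auto simp: eval_atom_def vars_atom_def intro!: eval_tm_cong elim: agree_on_subset)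

lemma sat_atomic_cong: "agree_on (vars_atomic a) \<sigma> \<tau> \<Longrightarrow> sat_atomic \<sigma> a = sat_atomic \<tau> a"
  by (cases a) (simp_all add: eval_iterm_cong[of _ \<sigma> \<tau>] eval_aterm_cong[of _ \<sigma> \<tau>])

lemma eval_var_tm [simp]: "eval_tm \<sigma> (var_tm X) = lookup \<sigma> X"
  by (cases X) auto

primrec sort_of_val :: "val \<Rightarrow> sort" where
  "sort_of_val (IntV i) = IntS"
| "sort_of_val (ArrV f) = ArrS"

lemma sort_of_val_eval_tm [simp]: "sort_of_val (eval_tm \<sigma> t) = sort_of t"
  by (cases t) auto

lemma ex_valuation_lookup:
  assumes "sort_of_val v = sort_of (var_tm X)"
  shows "\<exists>\<sigma>. lookup \<sigma> X = v"
proof (cases v)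
  case (IntV i)
  with assms have "lookup (Valuation (\<lambda>_. i) undefined) X = v" by (cases X) auto
  then show ?thesis ..
next
  case (ArrV f)
  with assms have "lookup (Valuation undefined (\<lambda>_. f)) X = v" by (cases X) auto
  then show ?thesis ..
qed

definition override_valuation :: "valuation \<Rightarrow> valuation \<Rightarrow> var set \<Rightarrow> valuation" where
  "override_valuation \<sigma> \<rho> V = Valuation
     (\<lambda>n. ival (if IV n \<in> V then \<rho> else \<sigma>) n) (\<lambda>n. aval (if AV n \<in> V then \<rho> else \<sigma>) n)"

lemma lookup_override_valuation [simp]:
  "lookup (override_valuation \<sigma> \<rho> V) X = lookup (if X \<in> V then \<rho> else \<sigma>) X"
  by (cases X) (auto simp: override_valuation_def)

lemma sat_override_valuation:
  assumes "sat \<sigma> c" "sat \<rho> c"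
    and closed: "\<And>a. a \<in> set c \<Longrightarrow> vars_atomic a \<subseteq> V \<or> vars_atomic a \<inter> V = {}"
  shows "sat (override_valuation \<sigma> \<rho> V) c"
  unfolding sat_def
proof
  let ?\<tau> = "override_valuation \<sigma> \<rho> V"
  fix a assume a: "a \<in> set c"
  consider (inside) "vars_atomic a \<subseteq> V" | (outside) "vars_atomic a \<inter> V = {}"
    using closed[OF a] by blast
  then show "sat_atomic ?\<tau> a"
  proof cases
    case inside
    then have "agree_on (vars_atomic a) ?\<tau> \<rho>" by (auto simp: agree_on_def)
    with \<open>sat \<rho> c\<close> a show ?thesis by (simp add: sat_atomic_cong sat_def)
  next
    case outside
    then have "agree_on (vars_atomic a) ?\<tau> \<sigma>" by (auto simp: agree_on_def)
    with \<open>sat \<sigma> c\<close> a show ?thesis by (simp add: sat_atomic_cong sat_def)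
  qed
qed


subsection \<open>Connected components of a constraint\<close>

lemma transp_constrained_to: "transp (constrained_to c)"
proof (rule transpI)
  show "constrained_to c X Z" if "constrained_to c X Y" "constrained_to c Y Z" for X Y Z
    using that by (induction rule: constrained_to.induct) (blast intro: constrained_to.step)+
qed

definition component :: "constraint \<Rightarrow> var \<Rightarrow> var set" where
  "component c X = insert X {Y. constrained_to c X Y}"

lemma vars_atomic_subset_component:
  assumes a: "a \<in> set c" and Y: "Y \<in> vars_atomic a" "Y \<in> component c X"
  shows "vars_atomic a \<subseteq> component c X"
proof
  fix Z assume "Z \<in> vars_atomic a"
  with a Y(1) have "constrained_to c Y Z" by (auto intro: constrained_to.direct)
  with Y(2) show "Z \<in> component c X"
    by (auto simp: component_def intro: transpD[OF transp_constrained_to])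
qed

lemma sat_reassign_var:
  assumes "sat \<sigma> c" "valid_forall_exists X c" "sort_of_val v = sort_of (var_tm X)"
  obtains \<sigma>' where "sat \<sigma>' c" "lookup \<sigma>' X = v" "agree_on (- component c X) \<sigma>' \<sigma>"
proof -
  obtain \<rho>\<^sub>0 where "lookup \<rho>\<^sub>0 X = v" using ex_valuation_lookup[OF assms(3)] by blast
  with assms(2) obtain \<rho> where \<rho>: "lookup \<rho> X = v" "sat \<rho> c"
    unfolding valid_forall_exists_def by (metis Diff_iff singletonI)
  let ?\<sigma>' = "override_valuation \<sigma> \<rho> (component c X)"
  have "sat ?\<sigma>' c"
    using assms(1) \<rho>(2) vars_atomic_subset_component by (blast intro: sat_override_valuation)
  moreover have "lookup ?\<sigma>' X = v" using \<rho>(1) by (simp add: component_def)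
  moreover have "agree_on (- component c X) ?\<sigma>' \<sigma>" by (simp add: agree_on_def)
  ultimately show thesis by (rule that)
qed


subsection \<open>Erasing atoms and programs\<close>

lemma pred_eval_atom [simp]: "pred (eval_atom \<sigma> A) = pred A"
  by (simp add: eval_atom_def)

lemma args_eval_atom [simp]: "args (eval_atom \<sigma> A) = map (eval_tm \<sigma>) (args A)"
  by (simp add: eval_atom_def)

lemma pred_erase_atom [simp]: "pred (erase_atom E A) = pred A"
  by (simp add: erase_atom_def)

lemma erase_atom_Nil [simp]: "erase_atom E (Atom p []) = Atom p []"
  by (simp add: erase_atom_def)

lemma eval_erase_atom: "eval_atom \<sigma> (erase_atom E A) = erase_atom E (eval_atom \<sigma> A)"
  by (simp add: erase_atom_def eval_atom_def nths_map)

lemma nths_eq_iff_nth: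
  assumes "length xs = length ys"
  shows "nths xs I = nths ys I \<longleftrightarrow> (\<forall>i<length xs. i \<in> I \<longrightarrow> xs ! i = ys ! i)"
  using assms
proof (induction xs ys arbitrary: I rule: list_induct2)
  case (Cons x xs y ys)
  then show ?case by (auto simp: nths_Cons All_less_Suc2)
qed simp

lemma erase_atom_eq_iff_nth:
  assumes "length (args A) = length (args B)"
  shows "erase_atom E A = erase_atom E B \<longleftrightarrow> pred A = pred B \<and>
    (\<forall>i<length (args A). (pred A, Suc i) \<notin> E \<longrightarrow> args A ! i = args B ! i)"
  using nths_eq_iff_nth[OF assms] by (auto simp: erase_atom_def)

lemma prog_atoms_erase_program: "prog_atoms (erase_program E P) = erase_atom E ` prog_atoms P"
  by (auto simp: prog_atoms_def erase_program_def erase_clause_def)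

lemma is_model_erase_program_iff:
  "is_model I (erase_program E P) \<longleftrightarrow>
     (\<forall>C\<in>P. \<forall>\<sigma>. sat \<sigma> (cons C) \<longrightarrow> (\<forall>A\<in>set (body C). erase_atom E (eval_atom \<sigma> A) \<in> I) \<longrightarrow>
        erase_atom E (eval_atom \<sigma> (head C)) \<in> I)"
  by (simp add: is_model_def erase_program_def erase_clause_def eval_erase_atom)

definition well_sorted :: "('t \<Rightarrow> sort) \<Rightarrow> ('p \<Rightarrow> sort list) \<Rightarrow> ('p, 't) atom \<Rightarrow> bool" where
  "well_sorted s sig A \<longleftrightarrow> map s (args A) = sig (pred A)"

lemma well_sorted_eval_atom [simp]:
  "well_sorted sort_of_val sig (eval_atom \<sigma> A) \<longleftrightarrow> well_sorted sort_of sig A"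
  by (simp add: well_sorted_def comp_def)

definition has_signature :: "'p program \<Rightarrow> ('p \<Rightarrow> sort list) \<Rightarrow> bool" where
  "has_signature P sig \<longleftrightarrow> (\<forall>A\<in>prog_atoms P. well_sorted sort_of sig A)"

lemma has_signature_headD: "has_signature P sig \<Longrightarrow> C \<in> P \<Longrightarrow> well_sorted sort_of sig (head C)"
  by (auto simp: has_signature_def prog_atoms_def)

lemma has_signature_bodyD:
  "has_signature P sig \<Longrightarrow> C \<in> P \<Longrightarrow> A \<in> set (body C) \<Longrightarrow> well_sorted sort_of sig A"
  by (auto simp: has_signature_def prog_atoms_def)

lemma clp_program_iff_has_signature: "clp_program P \<longleftrightarrow> finite P \<and> (\<exists>sig. has_signature P sig)"
  by (simp add: clp_program_def has_signature_def well_sorted_def)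

definition erase_signature :: "'p erasure \<Rightarrow> ('p \<Rightarrow> sort list) \<Rightarrow> 'p \<Rightarrow> sort list" where
  "erase_signature E sig p = nths (sig p) {i. (p, Suc i) \<notin> E}"

lemma has_signature_erase_program:
  assumes "has_signature P sig"
  shows "has_signature (erase_program E P) (erase_signature E sig)"
  using assms
  by (auto simp: has_signature_def well_sorted_def prog_atoms_erase_program erase_atom_def
      erase_signature_def nths_map[symmetric])

lemma clp_program_erase_program:
  assumes "clp_program P"
  shows "clp_program (erase_program E P)"
proof -
  from assms obtain sig where "finite P" "has_signature P sig"
    by (auto simp: clp_program_iff_has_signature)
  then have "finite (erase_program E P)" by (simp add: erase_program_def)
  moreover have "has_signature (erase_program E P) (erase_signature E sig)"
    using \<open>has_signature P sig\<close> by (rule has_signature_erase_program)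
  ultimately show ?thesis by (auto simp: clp_program_iff_has_signature)
qed


subsection \<open>Safe erasures\<close>

definition safe_erasure :: "'p program \<Rightarrow> 'p erasure \<Rightarrow> bool" where
  "safe_erasure P E \<longleftrightarrow> (\<forall>C\<in>P. \<forall>k. (pred (head C), k) \<in> E \<longrightarrow> safe_position E C k)"

lemma safe_position_update_head_arg:
  assumes safe: "safe_position E C (Suc i)"
    and sat: "sat \<sigma> (cons C)"
    and sort: "sort_of_val v = sort_of (args (head C) ! i)"
  obtains \<sigma>' where "sat \<sigma>' (cons C)"
    "args (eval_atom \<sigma>' (head C)) = (args (eval_atom \<sigma> (head C)))[i := v]"
    "\<And>A. A \<in> set (body C) \<Longrightarrow> eval_atom \<sigma>' (erase_atom E A) = eval_atom \<sigma> (erase_atom E A)"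
proof -
  let ?ts = "args (head C)" and ?c = "cons C"
  obtain X where X: "?ts ! i = var_tm X" and valid: "valid_forall_exists X ?c"
    and other: "\<forall>j<length ?ts. j \<noteq> i \<longrightarrow> X \<notin> vars_tm (?ts ! j)"
    and head: "\<forall>Y\<in>vars_atom (head C). Y \<noteq> X \<longrightarrow> \<not> constrained_to ?c X Y"
    and body: "\<forall>A\<in>set (body C). vars_atom (erase_atom E A) \<subseteq> - component ?c X"
    using safe by (auto simp: safe_position_def component_def subset_eq)
  obtain \<sigma>' where \<sigma>': "sat \<sigma>' ?c" "lookup \<sigma>' X = v" "agree_on (- component ?c X) \<sigma>' \<sigma>"
    using sat_reassign_var[OF sat valid] sort X by metis
  have unchanged: "eval_tm \<sigma>' (?ts ! j) = eval_tm \<sigma> (?ts ! j)"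
    if j: "j < length ?ts" "j \<noteq> i" for j
  proof -
    have "vars_tm (?ts ! j) \<subseteq> vars_atom (head C)"
      using nth_mem[OF j(1)] by (auto simp: vars_atom_def)
    with head other j have "vars_tm (?ts ! j) \<subseteq> - component ?c X"
      by (auto simp: component_def)
    with \<sigma>'(3) show ?thesis by (rule eval_tm_cong[OF agree_on_subset])
  qed
  have "args (eval_atom \<sigma>' (head C)) = (args (eval_atom \<sigma> (head C)))[i := v]"
  proof (rule nth_equalityI)
    show "args (eval_atom \<sigma>' (head C)) ! j = (args (eval_atom \<sigma> (head C)))[i := v] ! j"
      if "j < length (args (eval_atom \<sigma>' (head C)))" for j
      using that unchanged[of j] \<sigma>'(2) X by (cases "j = i") simp_all
  qed simp
  moreover have "eval_atom \<sigma>' (erase_atom E A) = eval_atom \<sigma> (erase_atom E A)"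
    if "A \<in> set (body C)" for A
    using \<sigma>'(3) bspec[OF body that] by (rule eval_atom_cong[OF agree_on_subset])
  ultimately show thesis by (rule that[OF \<sigma>'(1)])
qed

lemma safe_positions_update_head_args:
  assumes sorts: "map sort_of_val vs = map sort_of (args (head C))"
    and finite: "finite I" and bounded: "I \<subseteq> {..<length vs}"
    and safe: "\<And>i. i \<in> I \<Longrightarrow> safe_position E C (Suc i)"
    and sat: "sat \<sigma> (cons C)"
    and kept: "\<And>i. i < length vs \<Longrightarrow> i \<notin> I \<Longrightarrow> vs ! i = args (eval_atom \<sigma> (head C)) ! i"
  shows "\<exists>\<sigma>'. sat \<sigma>' (cons C) \<and> args (eval_atom \<sigma>' (head C)) = vs \<and>
    (\<forall>A\<in>set (body C). eval_atom \<sigma>' (erase_atom E A) = eval_atom \<sigma> (erase_atom E A))"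
  using finite bounded safe sat kept
proof (induction I arbitrary: \<sigma> rule: finite_induct)
  case empty
  have "args (eval_atom \<sigma> (head C)) = vs"
    using map_eq_imp_length_eq[OF sorts] empty.prems(4) by (intro nth_equalityI) simp_all
  with empty.prems(3) show ?case by blast
next
  case (insert i I)
  note bounded = insert.prems(1) and safe = insert.prems(2) and kept = insert.prems(4)
  have "sort_of_val (vs ! i) = sort_of (args (head C) ! i)"
    using sorts bounded by (metis insert_subset lessThan_iff length_map nth_map)
  with insert.prems(3) obtain \<sigma>\<^sub>1 where sat: "sat \<sigma>\<^sub>1 (cons C)"
    and head: "args (eval_atom \<sigma>\<^sub>1 (head C)) = (args (eval_atom \<sigma> (head C)))[i := vs ! i]"
    and body: "\<And>A. A \<in> set (body C) \<Longrightarrow>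
      eval_atom \<sigma>\<^sub>1 (erase_atom E A) = eval_atom \<sigma> (erase_atom E A)"
    using safe_position_update_head_arg[OF safe[OF insertI1]] by metis
  have "vs ! j = args (eval_atom \<sigma>\<^sub>1 (head C)) ! j" if "j < length vs" "j \<notin> I" for j
    using that kept[of j] map_eq_imp_length_eq[OF sorts] unfolding head
    by (cases "j = i") simp_all
  with insert.IH[OF _ _ sat] bounded safe body show ?case by simp
qed

lemma safe_erasure_head_preimage:
  assumes safe: "\<And>k. (pred (head C), k) \<in> E \<Longrightarrow> safe_position E C k"
    and sat: "sat \<sigma> (cons C)"
    and sorted: "well_sorted sort_of sig (head C)" "well_sorted sort_of_val sig B"
    and B: "erase_atom E B = erase_atom E (eval_atom \<sigma> (head C))"
  obtains \<sigma>' where "sat \<sigma>' (cons C)" "eval_atom \<sigma>' (head C) = B"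
    "\<And>A. A \<in> set (body C) \<Longrightarrow>
       erase_atom E (eval_atom \<sigma>' A) = erase_atom E (eval_atom \<sigma> A)"
proof -
  have pred: "pred B = pred (head C)" using arg_cong[OF B, of pred] by simp
  with sorted have sorts: "map sort_of_val (args B) = map sort_of (args (head C))"
    by (simp add: well_sorted_def)
  then have len: "length (args B) = length (args (eval_atom \<sigma> (head C)))"
    by (metis args_eval_atom length_map)
  define I where "I = {i. i < length (args B) \<and> (pred B, Suc i) \<in> E}"
  have "finite I" "I \<subseteq> {..<length (args B)}" by (auto simp: I_def)
  moreover have "safe_position E C (Suc i)" if "i \<in> I" for i
    using that safe pred by (simp add: I_def)
  moreover have "args B ! i = args (eval_atom \<sigma> (head C)) ! i"
    if "i < length (args B)" "i \<notin> I" for i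
    using that B erase_atom_eq_iff_nth[OF len] by (auto simp: I_def)
  ultimately obtain \<sigma>' where \<sigma>': "sat \<sigma>' (cons C)" "args (eval_atom \<sigma>' (head C)) = args B"
    "\<forall>A\<in>set (body C). eval_atom \<sigma>' (erase_atom E A) = eval_atom \<sigma> (erase_atom E A)"
    using safe_positions_update_head_args[OF sorts _ _ _ sat] by metis
  from \<sigma>'(2) pred have "eval_atom \<sigma>' (head C) = B" by (intro atom.expand) simp
  with \<sigma>'(1,3) that show thesis by (simp add: eval_erase_atom)
qed

definition full_fibers ::
    "('p \<Rightarrow> sort list) \<Rightarrow> 'p erasure \<Rightarrow> ('p, val) atom set \<Rightarrow> ('p, val) atom set" where
  "full_fibers sig E I = {B. \<forall>A. well_sorted sort_of_val sig A \<longrightarrow> erase_atom E A = B \<longrightarrow> A \<in> I}"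

lemma is_model_full_fibers:
  assumes sig: "has_signature P sig" and safe: "safe_erasure P E" and I: "is_model I P"
  shows "is_model (full_fibers sig E I) (erase_program E P)"
  unfolding is_model_erase_program_iff
proof (intro ballI allI impI)
  fix C \<sigma>
  assume C: "C \<in> P" and sat: "sat \<sigma> (cons C)"
    and body: "\<forall>A\<in>set (body C). erase_atom E (eval_atom \<sigma> A) \<in> full_fibers sig E I"
  show "erase_atom E (eval_atom \<sigma> (head C)) \<in> full_fibers sig E I"
    unfolding full_fibers_def
  proof (intro CollectI allI impI)
    fix B assume B: "well_sorted sort_of_val sig B"
      "erase_atom E B = erase_atom E (eval_atom \<sigma> (head C))"
    obtain \<sigma>' where \<sigma>': "sat \<sigma>' (cons C)" "eval_atom \<sigma>' (head C) = B"
      "\<And>A. A \<in> set (body C) \<Longrightarrow>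
         erase_atom E (eval_atom \<sigma>' A) = erase_atom E (eval_atom \<sigma> A)"
      using safe_erasure_head_preimage[OF _ sat has_signature_headD[OF sig C] B] safe C
      unfolding safe_erasure_def by metis
    have "eval_atom \<sigma>' A \<in> I" if A: "A \<in> set (body C)" for A
      using body A \<sigma>'(3)[OF A] has_signature_bodyD[OF sig C A]
      by (auto simp: full_fibers_def)
    with I C \<sigma>'(1,2) show "B \<in> I" unfolding is_model_def by blast
  qed
qed

lemma is_model_vimage_erase_atom:
  "is_model I (erase_program E P) \<Longrightarrow> is_model (erase_atom E -` I) P"
  unfolding is_model_erase_program_iff by (simp add: is_model_def)

theorem erase_atom_in_least_model_iff:
  assumes "has_signature P sig" "safe_erasure P E" "well_sorted sort_of_val sig A"
  shows "erase_atom E A \<in> least_model (erase_program E P) \<longleftrightarrow> A \<in> least_model P"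
proof
  assume "erase_atom E A \<in> least_model (erase_program E P)"
  also have "least_model (erase_program E P) \<subseteq> full_fibers sig E (least_model P)"
    using assms(1,2) is_model_least_model by (intro least_model_least is_model_full_fibers)
  finally show "A \<in> least_model P" using assms(3) by (simp add: full_fibers_def)
next
  assume "A \<in> least_model P"
  also have "least_model P \<subseteq> erase_atom E -` least_model (erase_program E P)"
    using is_model_least_model by (intro least_model_least is_model_vimage_erase_atom)
  finally show "erase_atom E A \<in> least_model (erase_program E P)" by simp
qed


subsection \<open>The cFAR algorithm\<close>

lemma finite_full_erasure:
  assumes "finite P"
  shows "finite (full_erasure P)"
proof -
  have "full_erasure P = (\<Union>A\<in>prog_atoms P. {pred A} \<times> {1..length (args A)})"
    by (auto simp: full_erasure_def)
  moreover have "finite (prog_atoms P)" using assms by (simp add: prog_atoms_def)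
  ultimately show ?thesis by simp
qed

lemma infinite_if_psubset_chain:
  fixes f :: "nat \<Rightarrow> 'a set"
  assumes chain: "\<And>i. f (Suc i) \<subset> f i"
  shows "infinite (f 0)"
proof
  assume "finite (f 0)"
  moreover have "f i \<subseteq> f 0" for i
    using chain lift_Suc_antimono_le[of f 0 i] by blast
  ultimately have "(f (Suc i), f i) \<in> finite_psubset" for i
    using chain by (auto simp: finite_psubset_def intro: finite_subset)
  then show False using wf_finite_psubset wf_iff_no_infinite_down_chain by blast
qed

lemma cfar_terminates_if_finite:
  assumes "finite P"
  shows "cfar_terminates P"
  unfolding cfar_terminates_def
proof
  assume "\<exists>f. f 0 = full_erasure P \<and> (\<forall>i. cfar_step P (f i) (f (Suc i)))"
  then obtain f where f: "f 0 = full_erasure P" "\<And>i. cfar_step P (f i) (f (Suc i))" by blast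
  have "f (Suc i) \<subset> f i" for i using f(2)[of i] by cases auto
  then have "infinite (f 0)" by (rule infinite_if_psubset_chain)
  with finite_full_erasure[OF assms] f(1) show False by simp
qed

lemma ex_cfar_output_if_terminates:
  assumes "cfar_terminates P"
  shows "\<exists>E. cfar_output P E"
proof (rule ccontr)
  let ?reachable = "(cfar_step P)\<^sup>*\<^sup>* (full_erasure P)"
  assume "\<nexists>E. cfar_output P E"
  then have continue: "\<exists>E'. cfar_step P E E'" if "?reachable E" for E
    using that unfolding cfar_output_def by blast
  have "\<exists>f. \<forall>i. (?reachable (f i) \<and> (i = 0 \<longrightarrow> f i = full_erasure P)) \<and>
      cfar_step P (f i) (f (Suc i))"
    by (rule dependent_nat_choice)
      (use continue in \<open>auto intro: rtranclp.rtrancl_into_rtrancl\<close>)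
  with assms show False unfolding cfar_terminates_def by blast
qed

lemma safe_erasure_if_cfar_output: "cfar_output P E \<Longrightarrow> safe_erasure P E"
  unfolding cfar_output_def safe_erasure_def by (blast intro: cfar_step.remove)

theorem theorem2:
  fixes Prog :: "'p program" and unsafe :: 'p
  assumes "clp_program Prog"
    and "Atom unsafe [] \<in> prog_atoms Prog"
  shows "cfar_terminates Prog \<and>
    (\<exists>E. cfar_output Prog E) \<and>
    (\<forall>E. cfar_output Prog E \<longrightarrow>
       clp_program (erase_program E Prog) \<and>
       (Atom unsafe [] \<in> least_model Prog \<longleftrightarrow> Atom unsafe [] \<in> least_model (erase_program E Prog)))"
proof (intro conjI allI impI)
  obtain sig where "finite Prog" and sig: "has_signature Prog sig"
    using assms(1) by (auto simp: clp_program_iff_has_signature)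
  then show "cfar_terminates Prog" by (simp add: cfar_terminates_if_finite)
  then show "\<exists>E. cfar_output Prog E" by (rule ex_cfar_output_if_terminates)
  fix E assume "cfar_output Prog E"
  then have safe: "safe_erasure Prog E" by (rule safe_erasure_if_cfar_output)
  show "clp_program (erase_program E Prog)"
    using assms(1) by (rule clp_program_erase_program)
  have "well_sorted sort_of_val sig (Atom unsafe [])"
    using sig assms(2) by (force simp: has_signature_def well_sorted_def)
  from erase_atom_in_least_model_iff[OF sig safe this]
  show "Atom unsafe [] \<in> least_model Prog \<longleftrightarrow>
      Atom unsafe [] \<in> least_model (erase_program E Prog)"
    by simp
qed

end
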